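(* Consider Scheme 2 (D2D mode used by default, channel access probability $q\in(0,1]$). Its operational region equals $\mathcal R^2=\mathcal R^1\cup\hat{\mathcal R}^2$, where for overlay D2D $$\mathcal R^1=\{c_1>e^{c_2}\},\qquad \hat{\mathcal R}^2=\{c_1>e\,c_2,\ c_2>1\},$$ and for underlay D2D $$\mathcal R^1=\{\bar c_1>e^{\bar c_2+\bar c_3}\},\qquad \hat{\mathcal R}^2=\{\bar c_1>e(\bar c_2+\bar c_3),\ \bar c_2+\bar c_3>1\}.$$ The rate-maximizing access probability is $q^*=\frac1{c_2}<1$ for overlay D2D and $q^*=\frac1{\bar c_2+\bar c_3}<1$ for underlay D2D when the operational point is in $\hat{\mathcal R}^2$, and $q^*=1$ for all other operational points of $\mathcal R^2$.
   Context: A D2D-enabled cellular network operates under Scheme 2: the D2D mode selection probability is fixed to $1$ and the D2D channel access probability is $q\in(0,1]$. The average user rate is $R=R_{\mathrm{noD2D}}(1+wf(q))$ with $R_{\mathrm{noD2D}},w>0$ independent of $q$, where $$f(q)=c_1q\,e^{-c_2q}-1\ \text{ (overlay)},\qquad f(q)=\bar c_1q\,e^{-(\bar c_2+\bar c_3)q}-1\ \text{ (underlay)}.$$ The operational point is encoded by $(c_1,c_2)\in(0,\infty)^2$ (overlay) or $(\bar c_1,\bar c_2,\bar c_3)\in(0,\infty)^3$ (underlay); all displayed sets are subsets of $(0,\infty)^2$, respectively $(0,\infty)^3$. The operational region $\mathcal R^2$ is the set of operational points for which some $q\in(0,1]$ gives $R>R_{\mathrm{noD2D}}$, i.e. $f(q)>0$.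 $q^*$ is the maximizer of $R$ (equivalently of $f$) over $q\in(0,1]$. $\mathcal R^1$ is the operational region of the baseline scheme with $q=1$. *)

theory Defs
  imports "HOL-Analysis.Analysis"
begin

definition overlay_points :: "(real \<times> real) set" where
  "overlay_points = {(c1, c2). c1 > 0 \<and> c2 > 0}"

definition underlay_points :: "(real \<times> real \<times> real) set" where
  "underlay_points = {(c1, c2, c3). c1 > 0 \<and> c2 > 0 \<and> c3 > 0}"

definition f_overlay :: "real \<times> real \<Rightarrow> real \<Rightarrow> real" where
  "f_overlay = (\<lambda>(c1, c2) q. c1 * q * exp (- c2 * q) - 1)"

definition f_underlay :: "real \<times> real \<times> real \<Rightarrow> real \<Rightarrow> real" where
  "f_underlay = (\<lambda>(c1, c2, c3) q. c1 * q * exp (- (c2 + c3) * q) - 1)"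

text \<open>
  The rate without D2D, \<open>R0\<close>, and the weight \<open>w\<close> do not depend on the access probability \<open>q\<close>,
  but may depend on the operational point \<open>x\<close>.
\<close>

definition user_rate ::
  "('a \<Rightarrow> real) \<Rightarrow> ('a \<Rightarrow> real) \<Rightarrow> ('a \<Rightarrow> real \<Rightarrow> real) \<Rightarrow> 'a \<Rightarrow> real \<Rightarrow> real" where
  "user_rate R0 w f x q = R0 x * (1 + w x * f x q)"

definition scheme2_region ::
  "'a set \<Rightarrow> ('a \<Rightarrow> real) \<Rightarrow> ('a \<Rightarrow> real) \<Rightarrow> ('a \<Rightarrow> real \<Rightarrow> real) \<Rightarrow> 'a set" where
  "scheme2_region P R0 w f = {x \<in> P. \<exists>q\<in>{0<..1}. user_rate R0 w f x q > R0 x}"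

definition baseline_region ::
  "'a set \<Rightarrow> ('a \<Rightarrow> real) \<Rightarrow> ('a \<Rightarrow> real) \<Rightarrow> ('a \<Rightarrow> real \<Rightarrow> real) \<Rightarrow> 'a set" where
  "baseline_region P R0 w f = {x \<in> P. user_rate R0 w f x 1 > R0 x}"

definition Rhat_overlay :: "(real \<times> real) set" where
  "Rhat_overlay = {(c1, c2) \<in> overlay_points. c1 > exp 1 * c2 \<and> c2 > 1}"

definition Rhat_underlay :: "(real \<times> real \<times> real) set" where
  "Rhat_underlay =
    {(c1, c2, c3) \<in> underlay_points. c1 > exp 1 * (c2 + c3) \<and> c2 + c3 > 1}"

definition optimal_access :: "(real \<Rightarrow> real) \<Rightarrow> real \<Rightarrow> bool" where
  "optimal_access R = is_arg_max R (\<lambda>q. q \<in> {0<..1})"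

end

(* With y = c q, the strict inequality y < exp (y - 1) for y \<noteq> 1 says that q exp (-c q) has its
   unique maximum 1 / (e c) over q > 0 at q = 1 / c; when c \<le> 1 this point is not below 1, and the
   same inequality bounds the function by its value at q = 1.  So some q in (0, 1] makes
   a q exp (-c q) exceed 1 exactly when the value at the respective maximiser does.  Both modes
   are instances, with c = c2 for overlay and c = c2 + c3 for underlay. *)

theory Submission
  imports Defs
begin

text \<open>The graph of \<open>exp\<close> lies strictly above its tangent at \<open>0\<close> away
  from the point of contact. Both maximisation bounds below rest on this, so no derivative of the
  rate is taken.\<close>

lemma less_exp_minus_one:
  fixes y :: real
  assumes "y \<noteq> 1"
  shows "y < exp (y - 1)"
  using exp_minus_greater[of "1 - y"] assms by simp

text \<open>The tangent bound at \<open>y = c * q\<close>, multiplied by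
  \<open>exp (- c * q)\<close>, loses its dependence on \<open>q\<close> on the right: only
  \<open>exp (- 1)\<close> remains, and dividing by \<open>c\<close> gives the claim. The right side
  is left unevaluated so that it reads as the value at \<open>1 / c\<close>.\<close>

lemma mult_exp_less_inverse:
  fixes c q :: real
  assumes "c > 0" "q \<noteq> 1 / c"
  shows "q * exp (- c * q) < 1 / c * exp (- c * (1 / c))"
proof -
  have "c * q < exp (c * q - 1)"
    using assms by (intro less_exp_minus_one) (auto simp: field_simps)
  then have "c * q * exp (- c * q) < exp (c * q - 1) * exp (- c * q)"
    by simp
  also have "\<dots> = exp (- 1)"
    by (simp flip: exp_add)
  finally show ?thesis
    using assms by (simp add: field_simps)
qed

text \<open>Here the tangent bound is taken at \<open>y = q\<close>. Since \<open>q - 1\<close> is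
  negative, \<open>c \<le> 1\<close> gives \<open>q - 1 \<le> c * (q - 1)\<close>, which weakens the
  bound to one whose exponent cancels against \<open>- c * q\<close> and leaves
  \<open>exp (- c)\<close>.\<close>

lemma mult_exp_less_one:
  fixes c q :: real
  assumes "c \<le> 1" "q < 1"
  shows "q * exp (- c * q) < 1 * exp (- c * 1)"
proof -
  have "q < exp (q - 1)"
    using assms by (intro less_exp_minus_one) auto
  also have "q - 1 \<le> c * q - c"
    using mult_right_mono_neg[of c 1 "q - 1"] assms by (simp add: algebra_simps)
  then have "exp (q - 1) \<le> exp (c * q - c)"
    by simp
  finally have "q * exp (- c * q) < exp (c * q - c) * exp (- c * q)"
    by simp
  then show ?thesis
    by (simp flip: exp_add)
qed

text \<open>The disjuncts test the values at \<open>1\<close> and at \<open>1 / c\<close>. They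
  overlap for \<open>c > 1\<close>; this form matches the union of the baseline region with the
  region gained by adapting \<open>q\<close>.\<close>

lemma ex_mult_exp_gt_one_iff:
  fixes a c :: real
  assumes "a > 0" "c > 0"
  shows "(\<exists>q\<in>{0<..1}. a * q * exp (- c * q) > 1) \<longleftrightarrow> a > exp c \<or> a > exp 1 * c \<and> c > 1"
    (is "?L \<longleftrightarrow> ?R")
proof
  have inv: "a * (1 / c) * exp (- c * (1 / c)) > 1 \<longleftrightarrow> a > exp 1 * c"
    using assms by (simp add: exp_minus field_simps)
  have one: "a * 1 * exp (- c * 1) > 1 \<longleftrightarrow> a > exp c"
    by (simp add: exp_minus field_simps)
  show ?R if ?L
  proof -
    from that obtain q where q: "0 < q" "q \<le> 1" "a * q * exp (- c * q) > 1"
      by auto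
    show ?R
    proof (cases "c > 1")
      case True
      \<comment> \<open>The given \<open>q\<close> may be the maximiser itself, so only a weak bound
        is available; strictness of the conclusion comes from the assumption that the value at
        \<open>q\<close> exceeds \<open>1\<close>.\<close>
      have "q * exp (- c * q) \<le> 1 / c * exp (- c * (1 / c))"
        using mult_exp_less_inverse[of c q] assms by (cases "q = 1 / c") auto
      then have "a * (q * exp (- c * q)) \<le> a * (1 / c * exp (- c * (1 / c)))"
        using assms by (intro mult_left_mono) auto
      then show ?thesis
        using True q inv by (auto simp only: mult.assoc)
    next
      case False
      have "q * exp (- c * q) \<le> 1 * exp (- c * 1)"
        using mult_exp_less_one[of c q] q False by (cases "q = 1") auto
      then have "a * (q * exp (- c * q)) \<le> a * (1 * exp (- c * 1))"
        using assms by (intro mult_left_mono) auto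
      then show ?thesis
        using q one by (auto simp only: mult.assoc)
    qed
  qed
  show ?L if ?R
    using that
  proof
    assume "a > exp c"
    with one show ?L
      by (intro bexI[of _ 1]) auto
  next
    assume "a > exp 1 * c \<and> c > 1"
    with inv show ?L
      by (intro bexI[of _ "1 / c"]) auto
  qed
qed

text \<open>Strict domination by \<open>r\<close> yields existence and uniqueness of the maximiser
  together, which is why the optimum can be characterised by an equivalence.\<close>

lemma optimal_access_iff:
  assumes "r \<in> {0<..1}" "\<And>q. q \<in> {0<..1} \<Longrightarrow> q \<noteq> r \<Longrightarrow> R q < R r"
  shows "optimal_access R q \<longleftrightarrow> q = r"
  using assms unfolding optimal_access_def is_arg_max_def by (metis order.asym order.irrefl)

lemma user_rate_less_iff:
  assumes "R0 x > 0" "w x > 0"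
  shows "user_rate R0 w f x p < user_rate R0 w f x q \<longleftrightarrow> f x p < f x q"
  using assms by (simp add: user_rate_def)

lemma user_rate_greater_iff:
  assumes "R0 x > 0" "w x > 0"
  shows "R0 x < user_rate R0 w f x q \<longleftrightarrow> 0 < f x q"
proof -
  have "R0 x < user_rate R0 w f x q \<longleftrightarrow> R0 x * 1 < R0 x * (1 + w x * f x q)"
    by (simp add: user_rate_def)
  also have "\<dots> \<longleftrightarrow> 0 < f x q"
    using assms by (simp only: mult_less_cancel_left_pos) (simp add: zero_less_mult_iff)
  finally show ?thesis .
qed

text \<open>The point \<open>x\<close> stays abstract and only \<open>f x\<close> is prescribed, so
  an overlay or underlay point is covered by choosing \<open>a\<close> and \<open>c\<close>.
  Positivity of \<open>R0\<close> and \<open>w\<close> is asked at this point alone.\<close>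

context
  fixes R0 w :: "'a \<Rightarrow> real" and f :: "'a \<Rightarrow> real \<Rightarrow> real" and x :: 'a and a c :: real
  assumes R0: "R0 x > 0" and w: "w x > 0" and a: "a > 0" and c: "c > 0"
    and f: "\<And>q. f x q = a * q * exp (- c * q) - 1"
begin

lemma optimal_access_inverse:
  assumes "c > 1"
  shows "optimal_access (user_rate R0 w f x) q \<longleftrightarrow> q = 1 / c"
proof (rule optimal_access_iff)
  show "user_rate R0 w f x p < user_rate R0 w f x (1 / c)" if "p \<noteq> 1 / c" for p
    using mult_strict_left_mono[OF mult_exp_less_inverse[OF c that] a]
    unfolding user_rate_less_iff[of R0 x w f, OF R0 w] f by (simp add: mult.assoc)
qed (use assms in auto)

lemma optimal_access_one:
  assumes "c \<le> 1"
  shows "optimal_access (user_rate R0 w f x) q \<longleftrightarrow> q = 1"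
proof (rule optimal_access_iff)
  show "user_rate R0 w f x p < user_rate R0 w f x 1" if "p \<in> {0<..1}" "p \<noteq> 1" for p
  proof -
    have "p < 1"
      using that by auto
    from mult_strict_left_mono[OF mult_exp_less_one[OF assms this] a] show ?thesis
      unfolding user_rate_less_iff[of R0 x w f, OF R0 w] f by (simp add: mult.assoc)
  qed
qed auto

lemma baseline_region_iff:
  assumes "x \<in> P"
  shows "x \<in> baseline_region P R0 w f \<longleftrightarrow> a > exp c"
  using assms user_rate_greater_iff[of R0 x w f, OF R0 w]
  by (simp add: baseline_region_def f exp_minus field_simps)

lemma scheme2_region_iff:
  assumes "x \<in> P"
  shows "x \<in> scheme2_region P R0 w f \<longleftrightarrow> a > exp c \<or> a > exp 1 * c \<and> c > 1"
  using assms user_rate_greater_iff[of R0 x w f, OF R0 w] ex_mult_exp_gt_one_iff[OF a c]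
  by (simp add: scheme2_region_def f)

text \<open>Membership in the region now forces \<open>exp c < a\<close>. The tangent bound at
  \<open>c - 1\<close> gives \<open>exp 1 * c \<le> exp c\<close>, hence
  \<open>a > exp 1 * c\<close>; the conjunct that fails must be \<open>c > 1\<close>, and the
  endpoint is optimal.\<close>

lemma optimal_access_one_of_not_gt:
  assumes "x \<in> P" "x \<in> scheme2_region P R0 w f" "\<not> (a > exp 1 * c \<and> c > 1)"
  shows "optimal_access (user_rate R0 w f x) q \<longleftrightarrow> q = 1"
proof (rule optimal_access_one)
  have "exp c < a"
    using scheme2_region_iff assms by auto
  moreover have "exp 1 * c \<le> exp c"
    using exp_ge_add_one_self[of "c - 1"] by (simp add: exp_diff field_simps)
  ultimately show "c \<le> 1"
    using assms by auto
qed

end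

theorem lemma6:
  fixes R0 w :: "real \<times> real \<Rightarrow> real"
    and R0u wu :: "real \<times> real \<times> real \<Rightarrow> real"
  assumes "\<And>x. x \<in> overlay_points \<Longrightarrow> R0 x > 0 \<and> w x > 0"
    and "\<And>x. x \<in> underlay_points \<Longrightarrow> R0u x > 0 \<and> wu x > 0"
  shows
    "(scheme2_region overlay_points R0 w f_overlay
       = baseline_region overlay_points R0 w f_overlay \<union> Rhat_overlay) \<and>
     (baseline_region overlay_points R0 w f_overlay
       = {(c1, c2) \<in> overlay_points. c1 > exp c2}) \<and>
     (scheme2_region underlay_points R0u wu f_underlay
       = baseline_region underlay_points R0u wu f_underlay \<union> Rhat_underlay) \<and>
     (baseline_region underlay_points R0u wu f_underlay
       = {(c1, c2, c3) \<in> underlay_points. c1 > exp (c2 + c3)}) \<and>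
     (\<forall>(c1, c2) \<in> Rhat_overlay.
       (\<forall>q. optimal_access (user_rate R0 w f_overlay (c1, c2)) q \<longleftrightarrow> q = 1 / c2) \<and> 1 / c2 < 1) \<and>
     (\<forall>x \<in> scheme2_region overlay_points R0 w f_overlay - Rhat_overlay.
       \<forall>q. optimal_access (user_rate R0 w f_overlay x) q \<longleftrightarrow> q = 1) \<and>
     (\<forall>(c1, c2, c3) \<in> Rhat_underlay.
       (\<forall>q. optimal_access (user_rate R0u wu f_underlay (c1, c2, c3)) q
              \<longleftrightarrow> q = 1 / (c2 + c3)) \<and> 1 / (c2 + c3) < 1) \<and>
     (\<forall>x \<in> scheme2_region underlay_points R0u wu f_underlay - Rhat_underlay.
       \<forall>q. optimal_access (user_rate R0u wu f_underlay x) q \<longleftrightarrow> q = 1)"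
proof -
  \<comment> \<open>The membership criteria apply only to points of \<open>P\<close>; these
    inclusions settle the remaining points in the set equalities below.\<close>
  have sub: "x \<in> scheme2_region P R w f \<Longrightarrow> x \<in> P" "x \<in> baseline_region P R w f \<Longrightarrow> x \<in> P"
    for P :: "'b set" and R w f x
    by (auto simp: scheme2_region_def baseline_region_def)
  \<comment> \<open>The facts are listed in the order of the context assumptions, so that
    \<open>OF o\<close> discharges them all at once.\<close>
  have o: "R0 (a, c) > 0" "w (a, c) > 0" "a > 0" "c > 0"
    "\<And>q. f_overlay (a, c) q = a * q * exp (- c * q) - 1" if "(a, c) \<in> overlay_points" for a c
    using that assms(1) by (auto simp: overlay_points_def f_overlay_def)
  \<comment> \<open>The underlay rate depends on the last two coordinates only through their sum,
    which takes the role of \<open>c\<close>.\<close>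
  have u: "R0u (a, c, d) > 0" "wu (a, c, d) > 0" "a > 0" "c + d > 0"
    "\<And>q. f_underlay (a, c, d) q = a * q * exp (- (c + d) * q) - 1"
    if "(a, c, d) \<in> underlay_points" for a c d
    using that assms(2) by (auto simp: underlay_points_def f_underlay_def)
  note o_base_iff = baseline_region_iff
    [of R0 "(a, c)" w a c f_overlay for a c, OF o]
  note u_base_iff = baseline_region_iff
    [of R0u "(a, c, d)" wu a "c + d" f_underlay for a c d, OF u]
  note o_region_iff = scheme2_region_iff
    [of R0 "(a, c)" w a c f_overlay for a c, OF o]
  note u_region_iff = scheme2_region_iff
    [of R0u "(a, c, d)" wu a "c + d" f_underlay for a c d, OF u]
  note o_opt_inv_iff = optimal_access_inverse
    [of R0 "(a, c)" w a c f_overlay for a c, OF o]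
  note u_opt_inv_iff = optimal_access_inverse
    [of R0u "(a, c, d)" wu a "c + d" f_underlay for a c d, OF u]
  have o_base: "baseline_region overlay_points R0 w f_overlay
      = {(c1, c2) \<in> overlay_points. c1 > exp c2}"
  proof (rule set_eqI)
    show "x \<in> baseline_region overlay_points R0 w f_overlay
      \<longleftrightarrow> x \<in> {(c1, c2) \<in> overlay_points. c1 > exp c2}" for x
      by (cases x; cases "x \<in> overlay_points")
        (auto simp: o_base_iff dest: sub(2))
  qed
  have u_base: "baseline_region underlay_points R0u wu f_underlay
      = {(c1, c2, c3) \<in> underlay_points. c1 > exp (c2 + c3)}"
  proof (rule set_eqI)
    show "x \<in> baseline_region underlay_points R0u wu f_underlay
      \<longleftrightarrow> x \<in> {(c1, c2, c3) \<in> underlay_points. c1 > exp (c2 + c3)}" for x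
      by (cases x; cases "x \<in> underlay_points")
        (auto simp: u_base_iff dest: sub(2))
  qed
  have o_region: "scheme2_region overlay_points R0 w f_overlay
      = baseline_region overlay_points R0 w f_overlay \<union> Rhat_overlay"
    \<comment> \<open>With the baseline region explicit, both sides reduce to the two disjuncts of
      the region criterion.\<close>
    unfolding o_base
  proof (rule set_eqI)
    show "x \<in> scheme2_region overlay_points R0 w f_overlay
      \<longleftrightarrow> x \<in> {(c1, c2) \<in> overlay_points. c1 > exp c2} \<union> Rhat_overlay" for x
      by (cases x; cases "x \<in> overlay_points")
        (auto simp: Rhat_overlay_def o_region_iff dest: sub(1))
  qed
  have u_region: "scheme2_region underlay_points R0u wu f_underlay
      = baseline_region underlay_points R0u wu f_underlay \<union> Rhat_underlay"
    unfolding u_base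
  proof (rule set_eqI)
    show "x \<in> scheme2_region underlay_points R0u wu f_underlay
      \<longleftrightarrow> x \<in> {(c1, c2, c3) \<in> underlay_points. c1 > exp (c2 + c3)} \<union> Rhat_underlay" for x
      by (cases x; cases "x \<in> underlay_points")
        (auto simp: Rhat_underlay_def u_region_iff dest: sub(1))
  qed
  have o_hat: "\<forall>(c1, c2) \<in> Rhat_overlay.
      (\<forall>q. optimal_access (user_rate R0 w f_overlay (c1, c2)) q \<longleftrightarrow> q = 1 / c2) \<and> 1 / c2 < 1"
    by (auto simp: Rhat_overlay_def o_opt_inv_iff)
  have u_hat: "\<forall>(c1, c2, c3) \<in> Rhat_underlay.
      (\<forall>q. optimal_access (user_rate R0u wu f_underlay (c1, c2, c3)) q \<longleftrightarrow> q = 1 / (c2 + c3)) \<and> 1 / (c2 + c3) < 1"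
    by (auto simp: Rhat_underlay_def u_opt_inv_iff)
  have o_rest: "\<forall>x \<in> scheme2_region overlay_points R0 w f_overlay - Rhat_overlay.
      \<forall>q. optimal_access (user_rate R0 w f_overlay x) q \<longleftrightarrow> q = 1"
  proof (intro ballI allI)
    fix x q
    assume x: "x \<in> scheme2_region overlay_points R0 w f_overlay - Rhat_overlay"
    obtain a c where [simp]: "x = (a, c)"
      by (cases x)
    have "(a, c) \<in> overlay_points"
      using x sub(1) by auto
    \<comment> \<open>For a point of \<open>overlay_points\<close>, lying outside
      \<open>Rhat_overlay\<close> is exactly the negated conjunction required by the lemma.\<close>
    then show "optimal_access (user_rate R0 w f_overlay x) q \<longleftrightarrow> q = 1"
      using x optimal_access_one_of_not_gt[of R0 "(a, c)" w a c f_overlay overlay_points, OF o]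
      by (auto simp: Rhat_overlay_def)
  qed
  have u_rest: "\<forall>x \<in> scheme2_region underlay_points R0u wu f_underlay - Rhat_underlay.
      \<forall>q. optimal_access (user_rate R0u wu f_underlay x) q \<longleftrightarrow> q = 1"
  proof (intro ballI allI)
    fix x q
    assume x: "x \<in> scheme2_region underlay_points R0u wu f_underlay - Rhat_underlay"
    obtain a c d where [simp]: "x = (a, c, d)"
      by (cases x)
    have "(a, c, d) \<in> underlay_points"
      using x sub(1) by auto
    then show "optimal_access (user_rate R0u wu f_underlay x) q \<longleftrightarrow> q = 1"
      using x optimal_access_one_of_not_gt[of R0u "(a, c, d)" wu a "c + d" f_underlay underlay_points, OF u]
      by (auto simp: Rhat_underlay_def)
  qed
  show ?thesis
    by (intro conjI o_region o_base u_region u_base o_hat o_rest u_hat u_rest)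
qed

end
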